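(* Every $f=h+\overline{g}\in\mathcal{H_R}$ is univalent and close-to-convex in $\mathbb{D}$.
   Context: Let $\mathbb{D}=\{z\in\mathbb{C}:|z|<1\}$. $\mathcal{A}$ is the class of analytic functions $h$ in $\mathbb{D}$ with $h(0)=0$, $h'(0)=1$. $\mathcal{H}$ is the class of all sense-preserving harmonic functions $f=h+\overline{g}$ in $\mathbb{D}$, with $h,g$ analytic in $\mathbb{D}$ of the form $h(z)=z+\sum_{n=2}^\infty a_nz^n$, $g(z)=\sum_{n=1}^\infty b_nz^n$; sense-preserving means that the Jacobian $J_f=|h'|^2-|g'|^2$ is positive in $\mathbb{D}$. $\mathcal{R}$ is the class of functions $h\in\mathcal{A}$ such that, for some $m\in\mathbb{N}=\{1,2,3,\dots\}$, $h'(z)=\frac{m}{m-z^m}$ for all $z\in\mathbb{D}$. $\mathcal{H_R}$ is the class of all $f=h+\overline{g}\in\mathcal{H}$ with $h\in\mathcal{R}$. Univalent means injective in $\mathbb{D}$. A univalent harmonic mapping $f$ of $\mathbb{D}$ is close-to-convex if $f(\mathbb{D})$ is a close-to-convex domain, i.e. the complement $\mathbb{C}\setminus f(\mathbb{D})$ is a union of non-crossing closed half-lines (half-lines whose relative interiors are pairwise disjoint); this is the standard (Clunie–Sheil-Small) notion. *)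

theory Defs
  imports "HOL-Complex_Analysis.Complex_Analysis"
begin

abbreviation unit_disc :: "complex set" (\<open>\<D>\<close>)
  where "\<D> \<equiv> ball 0 1"

text \<open>Functions on the disc are total functions here; all the conditions below depend only
  on their values in \<open>\<D>\<close>.\<close>

definition class_A :: "(complex \<Rightarrow> complex) set" where
  "class_A = {h. h holomorphic_on \<D> \<and> h 0 = 0 \<and> deriv h 0 = 1}"

text \<open>\<open>f = h + cnj g\<close> with \<open>h z = z + (\<Sum>n\<ge>2. a\<^sub>n * z ^ n)\<close> and
  \<open>g z = (\<Sum>n\<ge>1. b\<^sub>n * z ^ n)\<close> in the disc; the shape of the two power series is the
  normalisation \<open>h 0 = 0\<close>, \<open>h' 0 = 1\<close>, \<open>g 0 = 0\<close>.\<close>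

definition canonical_decomposition ::
  "(complex \<Rightarrow> complex) \<Rightarrow> (complex \<Rightarrow> complex) \<Rightarrow> (complex \<Rightarrow> complex) \<Rightarrow> bool" where
  "canonical_decomposition f h g \<longleftrightarrow>
     h \<in> class_A \<and> g holomorphic_on \<D> \<and> g 0 = 0 \<and> (\<forall>z\<in>\<D>. f z = h z + cnj (g z))"

definition jacobian :: "(complex \<Rightarrow> complex) \<Rightarrow> (complex \<Rightarrow> complex) \<Rightarrow> complex \<Rightarrow> real" where
  "jacobian h g z = (norm (deriv h z))\<^sup>2 - (norm (deriv g z))\<^sup>2"

definition sense_preserving :: "(complex \<Rightarrow> complex) \<Rightarrow> (complex \<Rightarrow> complex) \<Rightarrow> bool" where
  "sense_preserving h g \<longleftrightarrow> (\<forall>z\<in>\<D>. jacobian h g z > 0)"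

definition harmonic_representation ::
  "(complex \<Rightarrow> complex) \<Rightarrow> (complex \<Rightarrow> complex) \<Rightarrow> (complex \<Rightarrow> complex) \<Rightarrow> bool" where
  "harmonic_representation f h g \<longleftrightarrow> canonical_decomposition f h g \<and> sense_preserving h g"

definition class_H :: "(complex \<Rightarrow> complex) set" where
  "class_H = {f. \<exists>h g. harmonic_representation f h g}"

definition class_R :: "(complex \<Rightarrow> complex) set" where
  "class_R = {h \<in> class_A. \<exists>m::nat. m \<ge> 1 \<and>
     (\<forall>z\<in>\<D>. deriv h z = of_nat m / (of_nat m - z ^ m))}"

definition class_HR :: "(complex \<Rightarrow> complex) set" where
  "class_HR = {f \<in> class_H. \<exists>h g. harmonic_representation f h g \<and> h \<in> class_R}"

definition closed_half_line :: "complex set \<Rightarrow> bool" where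
  "closed_half_line L \<longleftrightarrow> (\<exists>a d. d \<noteq> 0 \<and> L = {a + of_real t * d | t::real. t \<ge> 0})"

definition non_crossing :: "complex set set \<Rightarrow> bool" where
  "non_crossing \<L> \<longleftrightarrow> pairwise (\<lambda>L M. disjnt (rel_interior L) (rel_interior M)) \<L>"

text \<open>The family \<open>\<L>\<close> may be empty, so the whole plane is close-to-convex.\<close>

definition close_to_convex_domain :: "complex set \<Rightarrow> bool" where
  "close_to_convex_domain \<Omega> \<longleftrightarrow>
     open \<Omega> \<and> connected \<Omega> \<and> \<Omega> \<noteq> {} \<and>
     (\<exists>\<L>. (\<forall>L\<in>\<L>. closed_half_line L) \<and> non_crossing \<L> \<and> - \<Omega> = \<Union>\<L>)"

definition univalent :: "(complex \<Rightarrow> complex) \<Rightarrow> bool" where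
  "univalent f \<longleftrightarrow> inj_on f \<D>"

definition close_to_convex :: "(complex \<Rightarrow> complex) \<Rightarrow> bool" where
  "close_to_convex f \<longleftrightarrow> univalent f \<and> close_to_convex_domain (f ` \<D>)"

end

theory Submission
  imports Defs
begin

text \<open>
  The analytic part \<open>h\<close> satisfies \<open>Re (1 + z h'' / h') > 0\<close>, so it maps the disc injectively onto a
  convex domain \<open>\<Omega>\<close>, and \<open>f = F \<circ> h\<close> with \<open>F w = w + cnj (g (h\<^sup>-\<^sup>1 w))\<close>. Since \<open>|g'| < |h'|\<close>, \<open>F\<close> differs
  from the identity by a strict contraction of \<open>\<Omega>\<close>; hence \<open>F\<close> is a strictly monotone map of the
  plane (in particular injective) and extends monotonically to \<open>closure \<Omega>\<close>.

  The complement of \<open>F \<Omega>\<close> is filled by the half-lines \<open>F w + t n\<close>, where \<open>w\<close> is a frontier point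
  and \<open>n\<close> an outer normal of \<open>\<Omega>\<close> at \<open>w\<close>. Monotonicity keeps them off \<open>F \<Omega>\<close> and from crossing. A
  point \<open>v\<close> is covered if the variational inequality \<open>(v - F w) \<bullet> (x - w) \<le> 0\<close> for all \<open>x\<close> in
  \<open>closure \<Omega>\<close> has a solution \<open>w\<close>; for bounded \<open>\<Omega>\<close> this follows from Brouwer's theorem. Only \<open>m = 1\<close>
  gives an unbounded \<open>\<Omega>\<close>, a half-strip invariant under translation to the right. There the
  inequality is solvable if \<open>Re v\<close> is less than the supremum \<open>a\<close> of \<open>Re\<close> on \<open>F \<Omega>\<close>, and the remaining
  half-plane \<open>Re v \<ge> a\<close> is filled by horizontal half-lines.
\<close>


subsection \<open>Half-lines and variational inequalities\<close>

text \<open>A small step from \<open>p\<close> in the direction \<open>n\<close> stays in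
  \<open>S\<close> and increases the inner product by a positive amount, so equality at
  \<open>p\<close> is impossible.\<close>

lemma supporting_normal_interior:
  fixes S :: "'a::euclidean_space set"
  assumes "n \<noteq> 0" "p \<in> interior S" "\<And>x. x \<in> S \<Longrightarrow> n \<bullet> (x - w) \<le> 0"
  shows "n \<bullet> (p - w) < 0"
proof -
  obtain e where e: "e > 0" "cball p e \<subseteq> S"
    using assms(2) mem_interior_cball by blast
  have "p + (e / norm n) *\<^sub>R n \<in> cball p e"
    using assms(1) e by (simp add: dist_norm)
  then have "n \<bullet> (p + (e / norm n) *\<^sub>R n - w) \<le> 0"
    using assms(3) e by blast
  moreover have "n \<bullet> (p + (e / norm n) *\<^sub>R n - w) = n \<bullet> (p - w) + (e / norm n) * (n \<bullet> n)"
    by (simp add: algebra_simps)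
  moreover have "(e / norm n) * (n \<bullet> n) > 0" using assms e by simp
  ultimately show ?thesis by linarith
qed

definition ray :: "complex \<Rightarrow> complex \<Rightarrow> complex set" where
  "ray p d = {p + of_real t * d | t::real. t \<ge> 0}"

lemma closed_half_line_ray: "d \<noteq> 0 \<Longrightarrow> closed_half_line (ray p d)"
  unfolding closed_half_line_def ray_def by blast

lemma ray_eqI:
  assumes "c > 0"
  shows "ray p (of_real c * d) = ray p d"
proof -
  have "\<exists>s\<ge>0. of_real t * (of_real c * d) = of_real s * d" if "t \<ge> 0" for t
    using that assms by (intro exI[of _ "t * c"]) auto
  moreover have "\<exists>s\<ge>0. of_real t * d = of_real s * (of_real c * d)" if "t \<ge> 0" for t
    using that assms by (intro exI[of _ "t / c"]) auto
  ultimately show ?thesis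
    unfolding ray_def by (auto; metis)
qed

lemma rel_interior_ray_subset:
  assumes "d \<noteq> 0"
  shows "rel_interior (ray p d) \<subseteq> {p + of_real t * d | t::real. t > 0}"
proof
  fix z assume z: "z \<in> rel_interior (ray p d)"
  have "ray p d = (\<lambda>x. p + x) ` (\<lambda>t. of_real t * d) ` {0..}"
    unfolding ray_def by auto
  moreover have "linear (\<lambda>t. of_real t * d)"
    by (intro linearI) (simp_all add: algebra_simps scaleR_conv_of_real)
  ultimately have conv: "convex (ray p d)"
    by (simp add: convex_linear_image)
  obtain t where t: "t \<ge> 0" "z = p + of_real t * d"
    using z rel_interior_subset unfolding ray_def by blast
  have "t \<noteq> 0"
  proof
    assume "t = 0"
    \<comment> \<open>From a relative interior point the segment coming from \<open>p + d\<close>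
      can be prolonged inside the ray; beyond \<open>p\<close> the parameter would be
      \<open>1 - e < 0\<close>.\<close>
    have d: "p + d \<in> ray p d"
      unfolding ray_def by (auto intro!: exI[of _ 1])
    then obtain e where e: "e > 1" "(1 - e) *\<^sub>R (p + d) + e *\<^sub>R z \<in> ray p d"
      using z convex_rel_interior_iff[OF conv] by blast
    then obtain s where s: "s \<ge> 0" "(1 - e) *\<^sub>R (p + d) + e *\<^sub>R p = p + of_real s * d"
      using t \<open>t = 0\<close> unfolding ray_def by auto
    then have "of_real (1 - e - s) * d = 0"
      by (simp add: scaleR_conv_of_real algebra_simps)
    with assms have "1 - e - s = 0"
      by (metis mult_eq_0_iff of_real_eq_0_iff)
    with e s show False by simp
  qed
  with t show "z \<in> {p + of_real t * d | t::real. t > 0}" by auto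
qed

text \<open>Brouwer's theorem gives a point \<open>w\<close> that is its own projection, the nearest
  point of \<open>C\<close> to \<open>v + A w\<close>. The obtuse angle property of nearest points
  is then the inequality.\<close>

lemma variational_inequality:
  fixes A :: "'a::euclidean_space \<Rightarrow> 'a"
  assumes "compact C" "convex C" "C \<noteq> {}" "continuous_on C A"
  obtains w where "w \<in> C" "\<And>x. x \<in> C \<Longrightarrow> (v - (w - A w)) \<bullet> (x - w) \<le> 0"
proof -
  have cl: "closed C" using assms compact_imp_closed by blast
  obtain w where w: "w \<in> C" "closest_point C (v + A w) = w"
  proof (rule brouwer[OF assms(1-3), of "\<lambda>w. closest_point C (v + A w)"])
    show "continuous_on C (\<lambda>w. closest_point C (v + A w))"
      using assms cl
      by (intro continuous_on_compose2[OF continuous_on_closest_point[of C UNIV]])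
         (auto intro!: continuous_intros)
  qed (use assms cl in \<open>auto intro: closest_point_in_set\<close>)
  show thesis
  proof
    fix x assume "x \<in> C"
    from closest_point_dot[OF assms(2) cl this, of "v + A w"] w
    show "(v - (w - A w)) \<bullet> (x - w) \<le> 0" by (simp add: algebra_simps)
  qed (rule w)
qed

text \<open>The variational inequality is local, so it may be solved on a truncation of \<open>C\<close>.\<close>

lemma variational_inequality_local:
  fixes C :: "'a::euclidean_space set"
  assumes "convex C" "w \<in> C" "open U" "w \<in> U"
    and "\<And>x. x \<in> C \<inter> U \<Longrightarrow> n \<bullet> (x - w) \<le> 0" and x: "x \<in> C"
  shows "n \<bullet> (x - w) \<le> 0"
proof -
  have "((\<lambda>t. w + t *\<^sub>R (x - w)) \<longlongrightarrow> w + 0 *\<^sub>R (x - w)) (at_right (0::real))"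
    by (intro tendsto_intros)
  then have "eventually (\<lambda>t. w + t *\<^sub>R (x - w) \<in> U) (at_right (0::real))"
    using topological_tendstoD[OF _ \<open>open U\<close>] \<open>w \<in> U\<close> by simp
  moreover have "eventually (\<lambda>t. 0 < t \<and> t < 1) (at_right (0::real))"
    by (auto simp: eventually_at_right_field intro!: exI[of _ 1])
  ultimately obtain t where t: "0 < t" "t < 1" "w + t *\<^sub>R (x - w) \<in> U"
    using eventually_happens'[OF trivial_limit_at_right_real] eventually_conj by blast
  have "w + t *\<^sub>R (x - w) = (1 - t) *\<^sub>R w + t *\<^sub>R x" by (simp add: algebra_simps)
  also have "\<dots> \<in> C" using assms t by (intro convexD) auto
  finally have "n \<bullet> (t *\<^sub>R (x - w)) \<le> 0" using assms(5)[of "w + t *\<^sub>R (x - w)"] t by simp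
  then show ?thesis using t by (simp add: mult_le_0_iff)
qed

subsection \<open>Strictly monotone perturbations of the identity\<close>

locale contraction_perturbation =
  fixes \<Omega> :: "complex set" and A :: "complex \<Rightarrow> complex"
  assumes open_dom: "open \<Omega>" and convex_dom: "convex \<Omega>" and dom_nonempty: "\<Omega> \<noteq> {}"
    and nonexpansive: "1-lipschitz_on (closure \<Omega>) A"
    and strict: "\<And>z w. z \<in> \<Omega> \<Longrightarrow> w \<in> \<Omega> \<Longrightarrow> z \<noteq> w \<Longrightarrow> norm (A z - A w) < norm (z - w)"
begin

definition F :: "complex \<Rightarrow> complex" where "F w = w - A w"

definition outer_normal :: "complex \<Rightarrow> complex \<Rightarrow> bool" where
  "outer_normal w n \<longleftrightarrow> (\<forall>x\<in>closure \<Omega>. n \<bullet> (x - w) \<le> 0)"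

definition normal_rays :: "complex set set" where
  "normal_rays = {ray (F w) n | w n. w \<in> frontier \<Omega> \<and> n \<noteq> 0 \<and> outer_normal w n}"

lemma nonexpansive_norm:
  "z \<in> closure \<Omega> \<Longrightarrow> w \<in> closure \<Omega> \<Longrightarrow> norm (A z - A w) \<le> norm (z - w)"
  using lipschitz_onD[OF nonexpansive] by (simp add: dist_norm)

text \<open>The midpoint \<open>u\<close> of \<open>z\<close> and \<open>w\<close> lies in the open
  domain: the half from \<open>z\<close> to \<open>u\<close> contracts strictly and the half from
  \<open>u\<close> to \<open>w\<close> does not expand.\<close>

lemma strict_closure:
  assumes "z \<in> \<Omega>" "w \<in> closure \<Omega>" "z \<noteq> w"
  shows "norm (A z - A w) < norm (z - w)"
proof -
  define u where "u = (1/2) *\<^sub>R (z + w)"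
  have "u = w - (1/2) *\<^sub>R (w - z)"
    by (simp add: u_def scaleR_conv_of_real field_simps)
  also have "\<dots> \<in> interior \<Omega>"
    using assms open_dom interior_open
    by (intro mem_interior_closure_convex_shrink[OF convex_dom]) auto
  finally have u: "u \<in> \<Omega>" using open_dom interior_open by auto
  have zu: "z - u = (1/2) *\<^sub>R (z - w)" and uw: "u - w = (1/2) *\<^sub>R (z - w)"
    by (simp_all add: u_def scaleR_conv_of_real field_simps)
  have "z \<noteq> u" using zu assms by auto
  then have "norm (A z - A u) < norm (z - u)"
    using strict assms u by blast
  moreover have "norm (A u - A w) \<le> norm (u - w)"
    using nonexpansive_norm u assms closure_subset by blast
  moreover have "norm (A z - A w) \<le> norm (A z - A u) + norm (A u - A w)"
    using norm_triangle_ineq[of "A z - A u" "A u - A w"] by simp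
  ultimately show ?thesis unfolding zu uw by simp
qed

lemma inner_F_diff: "(F z - F w) \<bullet> (z - w) = (norm (z - w))\<^sup>2 - (A z - A w) \<bullet> (z - w)"
  by (simp add: F_def power2_norm_eq_inner algebra_simps)

lemma F_monotone:
  assumes "z \<in> closure \<Omega>" "w \<in> closure \<Omega>"
  shows "(F z - F w) \<bullet> (z - w) \<ge> 0"
proof -
  have "(A z - A w) \<bullet> (z - w) \<le> norm (A z - A w) * norm (z - w)"
    by (rule norm_cauchy_schwarz)
  also have "\<dots> \<le> norm (z - w) * norm (z - w)"
    using nonexpansive_norm assms by (intro mult_right_mono) auto
  finally show ?thesis by (simp add: inner_F_diff power2_eq_square)
qed

lemma F_strict_monotone:
  assumes "z \<in> \<Omega>" "w \<in> closure \<Omega>" "z \<noteq> w"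
  shows "(F z - F w) \<bullet> (z - w) > 0"
proof -
  have "(A z - A w) \<bullet> (z - w) \<le> norm (A z - A w) * norm (z - w)"
    by (rule norm_cauchy_schwarz)
  also have "\<dots> < norm (z - w) * norm (z - w)"
    using strict_closure assms by (intro mult_strict_right_mono) auto
  finally show ?thesis by (simp add: inner_F_diff power2_eq_square)
qed

lemma continuous_A: "continuous_on (closure \<Omega>) A"
  using nonexpansive by (rule lipschitz_on_continuous_on)

lemma continuous_F: "continuous_on (closure \<Omega>) F"
  unfolding F_def by (intro continuous_intros continuous_A)

lemma inj_F: "inj_on F \<Omega>"
proof (rule inj_onI)
  fix z w assume "z \<in> \<Omega>" "w \<in> \<Omega>" "F z = F w"
  then show "z = w" using F_strict_monotone[of z w] closure_subset by fastforce
qed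

lemma open_image_F: "open (F ` \<Omega>)"
  using invariance_of_domain open_dom inj_F continuous_F closure_subset continuous_on_subset
  by metis

lemma connected_image_F: "connected (F ` \<Omega>)"
  using continuous_F closure_subset continuous_on_subset convex_connected[OF convex_dom]
  by (metis connected_continuous_image)

lemma outer_normal_strict:
  assumes "outer_normal w n" "n \<noteq> 0" "z \<in> \<Omega>"
  shows "n \<bullet> (z - w) < 0"
  using supporting_normal_interior[of n z "closure \<Omega>" w] assms open_dom
    interior_mono[OF closure_subset, of \<Omega>]
  unfolding outer_normal_def by (simp add: interior_open subset_iff)

lemma frontier_dom: "w \<in> frontier \<Omega> \<longleftrightarrow> w \<in> closure \<Omega> \<and> w \<notin> \<Omega>"
  using open_dom by (simp add: frontier_def interior_open)

text \<open>If \<open>F z\<close> were on the ray, \<open>(F z - F w) \<bullet> (z - w)\<close>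
  would be a nonnegative multiple of \<open>n \<bullet> (z - w) < 0\<close>, against strict
  monotonicity.\<close>

lemma normal_ray_disjoint_image:
  assumes "L \<in> normal_rays"
  shows "L \<inter> F ` \<Omega> = {}"
proof -
  obtain w n where L: "L = ray (F w) n" "w \<in> closure \<Omega>" "w \<notin> \<Omega>" "n \<noteq> 0" "outer_normal w n"
    using assms unfolding normal_rays_def frontier_dom by blast
  have False if "z \<in> \<Omega>" "t \<ge> 0" "F z = F w + of_real t * n" for z t
  proof -
    have "t * (n \<bullet> (z - w)) \<le> 0"
      using outer_normal_strict[OF L(5,4) that(1)] that(2) by (simp add: mult_nonneg_nonpos)
    moreover have "(F z - F w) \<bullet> (z - w) = t * (n \<bullet> (z - w))"
      using that(3) by (simp flip: scaleR_conv_of_real)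
    ultimately show False using F_strict_monotone[of z w] L that by fastforce
  qed
  then show ?thesis unfolding L ray_def by fastforce
qed

text \<open>Two normals that meet make the inner product of \<open>F w1 - F w2\<close> and \<open>w1 - w2\<close> nonpositive, hence
  zero by monotonicity; as \<open>A\<close> is nonexpansive, this forces \<open>F w1 = F w2\<close>.\<close>

lemma normal_rays_meet:
  assumes w: "w1 \<in> closure \<Omega>" "w2 \<in> closure \<Omega>"
    and n: "outer_normal w1 n1" "outer_normal w2 n2" "n1 \<noteq> 0" "n2 \<noteq> 0"
    and t: "t1 > 0" "t2 > 0" and eq: "F w1 + of_real t1 * n1 = F w2 + of_real t2 * n2"
  shows "ray (F w1) n1 = ray (F w2) n2"
proof -
  have diff: "F w1 - F w2 = t2 *\<^sub>R n2 - t1 *\<^sub>R n1"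
    using eq by (simp add: scaleR_conv_of_real algebra_simps)
  have le: "n1 \<bullet> (w2 - w1) \<le> 0" "n2 \<bullet> (w1 - w2) \<le> 0"
    using n w unfolding outer_normal_def by auto
  have "(F w1 - F w2) \<bullet> (w1 - w2) = t2 * (n2 \<bullet> (w1 - w2)) + t1 * (n1 \<bullet> (w2 - w1))"
    unfolding diff by (simp add: algebra_simps)
  moreover have "t2 * (n2 \<bullet> (w1 - w2)) \<le> 0" "t1 * (n1 \<bullet> (w2 - w1)) \<le> 0"
    using le t by (simp_all add: mult_le_0_iff)
  ultimately have F0: "(F w1 - F w2) \<bullet> (w1 - w2) = 0"
    using F_monotone[OF w] by linarith
  have F: "F w1 = F w2"
  proof -
    \<comment> \<open>This is the expansion of the squared norm of
      \<open>A w1 - A w2 = (w1 - w2) - (F w1 - F w2)\<close>, solved for the \<open>F\<close>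
      term.\<close>
    have "(norm (F w1 - F w2))\<^sup>2
        = 2 * ((F w1 - F w2) \<bullet> (w1 - w2)) + (norm (A w1 - A w2))\<^sup>2 - (norm (w1 - w2))\<^sup>2"
      unfolding F_def power2_norm_eq_inner by (simp add: algebra_simps inner_commute)
    also have "\<dots> \<le> 0"
      using F0 nonexpansive_norm[OF w] by (simp add: power_mono)
    finally show ?thesis by simp
  qed
  have teq: "t1 *\<^sub>R n1 = t2 *\<^sub>R n2" using diff F by simp
  then have "n1 = (t2 / t1) *\<^sub>R n2"
    using t by (metis divide_inverse_commute eq_vector_fraction_iff less_numeral_extra(3) scaleR_scaleR)
  then show ?thesis using F ray_eqI[of "t2 / t1" "F w2" n2] t by (simp add: scaleR_conv_of_real)
qed

lemma normal_rays_non_crossing: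
  assumes "L \<in> normal_rays" "M \<in> normal_rays" "L \<noteq> M"
  shows "disjnt (rel_interior L) (rel_interior M)"
proof (rule ccontr)
  assume "\<not> ?thesis"
  then obtain z where z: "z \<in> rel_interior L" "z \<in> rel_interior M" unfolding disjnt_def by blast
  obtain w1 n1 w2 n2 where *:
    "L = ray (F w1) n1" "w1 \<in> closure \<Omega>" "n1 \<noteq> 0" "outer_normal w1 n1"
    "M = ray (F w2) n2" "w2 \<in> closure \<Omega>" "n2 \<noteq> 0" "outer_normal w2 n2"
    using assms unfolding normal_rays_def frontier_dom by blast
  then obtain t1 t2 where "t1 > 0" "t2 > 0"
      "z = F w1 + of_real t1 * n1" "z = F w2 + of_real t2 * n2"
    using z rel_interior_ray_subset by blast
  with * have "L = M" using normal_rays_meet by metis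
  with assms show False by blast
qed

text \<open>The point \<open>v\<close> has parameter 1 on the ray from \<open>F w\<close> in the
  direction \<open>v - F w\<close>. If that direction vanishes, any nonzero outer normal at
  \<open>w\<close> gives a ray starting at \<open>v\<close>.\<close>

lemma variational_solution_in_normal_ray:
  assumes v: "v \<notin> F ` \<Omega>" and w: "w \<in> closure \<Omega>" and n: "outer_normal w (v - F w)"
  shows "v \<in> \<Union>normal_rays"
proof -
  \<comment> \<open>At \<open>z = w\<close> the strict normal inequality reads 0 < 0; this leaves
    only \<open>v = F w\<close>, which \<open>v\<close> outside the image excludes.\<close>
  have "w \<notin> \<Omega>"
    using outer_normal_strict[OF n, of w] v by auto
  then have fr: "w \<in> frontier \<Omega>" using w frontier_dom by blast
  show ?thesis
  proof (cases "v = F w")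
    case True
    have "w \<notin> rel_interior (closure \<Omega>)"
      using \<open>w \<notin> \<Omega>\<close> rel_interior_subset convex_rel_interior_closure[OF convex_dom] by blast
    then obtain a where a: "a \<noteq> 0" "\<forall>y\<in>closure \<Omega>. a \<bullet> w \<le> a \<bullet> y"
      using supporting_hyperplane_rel_boundary[OF convex_closure[OF convex_dom] w] by metis
    then have "outer_normal w (- a)"
      unfolding outer_normal_def by (auto simp: algebra_simps)
    moreover have "v \<in> ray (F w) (- a)"
      unfolding ray_def True by (auto intro!: exI[of _ 0])
    moreover have "ray (F w) (- a) \<in> normal_rays" if "outer_normal w (- a)"
      using that a fr unfolding normal_rays_def by (intro CollectI exI[of _ w] exI[of _ "- a"]) auto
    ultimately show ?thesis by blast
  next
    case False
    have "v \<in> ray (F w) (v - F w)"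
      unfolding ray_def by (auto intro!: exI[of _ 1])
    moreover have "ray (F w) (v - F w) \<in> normal_rays"
      using False n fr unfolding normal_rays_def
      by (intro CollectI exI[of _ w] exI[of _ "v - F w"]) auto
    ultimately show ?thesis by blast
  qed
qed

lemma normal_rays_half_lines: "L \<in> normal_rays \<Longrightarrow> closed_half_line L"
  unfolding normal_rays_def using closed_half_line_ray by blast

section \<open>Close-to-convexity of the image\<close>

lemma close_to_convex_imageI:
  assumes "\<And>L. L \<in> \<L> \<Longrightarrow> closed_half_line L"
    and "pairwise (\<lambda>L M. disjnt (rel_interior L) (rel_interior M)) \<L>" and "- (F ` \<Omega>) = \<Union>\<L>"
  shows "close_to_convex_domain (F ` \<Omega>)"
  unfolding close_to_convex_domain_def non_crossing_def
  using assms open_image_F connected_image_F dom_nonempty by blast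

theorem close_to_convex_image_bounded:
  assumes "bounded \<Omega>"
  shows "close_to_convex_domain (F ` \<Omega>)"
proof -
  have "v \<in> \<Union>normal_rays" if v: "v \<notin> F ` \<Omega>" for v
  proof -
    have "compact (closure \<Omega>)" "convex (closure \<Omega>)" "closure \<Omega> \<noteq> {}"
      using assms convex_dom dom_nonempty by (auto simp: convex_closure)
    then obtain w where "w \<in> closure \<Omega>" "\<And>x. x \<in> closure \<Omega> \<Longrightarrow> (v - (w - A w)) \<bullet> (x - w) \<le> 0"
      using variational_inequality continuous_A by blast
    then show ?thesis
      using variational_solution_in_normal_ray[OF v] unfolding outer_normal_def F_def by blast
  qed
  then have "- (F ` \<Omega>) = \<Union>normal_rays"
    using normal_ray_disjoint_image by blast
  then show ?thesis
    using close_to_convex_imageI[OF normal_rays_half_lines] normal_rays_non_crossing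
    by (simp add: pairwise_def)
qed

theorem close_to_convex_image_half_strip:
  assumes im: "\<And>w. w \<in> \<Omega> \<Longrightarrow> \<bar>Im w\<bar> \<le> M" and re: "\<And>w. w \<in> \<Omega> \<Longrightarrow> - M \<le> Re w"
    and transl: "\<And>w t. w \<in> \<Omega> \<Longrightarrow> t \<ge> 0 \<Longrightarrow> w + of_real t \<in> \<Omega>"
  shows "close_to_convex_domain (F ` \<Omega>)"
proof -
  have closed_strip: "closed {w. \<bar>Im w\<bar> \<le> M \<and> - M \<le> Re w}"
    by (intro closed_Collect_conj closed_Collect_le continuous_intros)
  have "closure \<Omega> \<subseteq> {w. \<bar>Im w\<bar> \<le> M \<and> - M \<le> Re w}"
    by (rule closure_minimal) (use im re closed_strip in auto)
  then have strip: "\<bar>Im w\<bar> \<le> M" "- M \<le> Re w" if "w \<in> closure \<Omega>" for w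
    using that by auto
  have solve: "v \<in> \<Union>normal_rays" if v: "v \<notin> F ` \<Omega>" and u: "u \<in> \<Omega>" "Re v < Re (F u)" for u v
  proof -
    define \<delta> where "\<delta> = Re (F u) - Re v"
    \<comment> \<open>\<open>R\<close> exceeds by one the bound for \<open>Re w\<close> obtained
      below for a solution on the truncated set. The cut is therefore inactive at \<open>w\<close>,
      and the inequality extends to the whole closure.\<close>
    define R where "R = Re u + \<bar>Im (v - F u)\<bar> * (2 * M) / \<delta> + 1"
    have \<delta>: "\<delta> > 0" using u \<delta>_def by simp
    have M: "M \<ge> 0" using im[OF u(1)] by simp
    have uc: "u \<in> closure \<Omega>" using u closure_subset by blast
    let ?C = "closure \<Omega> \<inter> {w. Re w \<le> R}"
    have "?C \<subseteq> cbox (Complex (- M) (- M)) (Complex R M)"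
    proof
      fix w assume "w \<in> ?C"
      then show "w \<in> cbox (Complex (- M) (- M)) (Complex R M)"
        using strip[of w] by (simp add: in_cbox_complex_iff abs_le_iff)
    qed
    then have "bounded ?C"
      using bounded_cbox bounded_subset by blast
    then have "compact ?C"
      by (simp add: compact_eq_bounded_closed closed_Int closed_halfspace_Re_le)
    moreover have "convex ?C"
      by (intro convex_Int convex_closure convex_dom convex_halfspace_Re_le)
    moreover have "u \<in> ?C" using uc M \<delta> by (simp add: R_def)
    moreover have "continuous_on ?C A" using continuous_A continuous_on_subset by blast
    ultimately obtain w where w: "w \<in> ?C" "\<And>x. x \<in> ?C \<Longrightarrow> (v - F w) \<bullet> (x - w) \<le> 0"
      using variational_inequality[of ?C A v] unfolding F_def by blast
    \<comment> \<open>Testing with \<open>u\<close> and using monotonicity replaces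
      \<open>F w\<close> by the fixed \<open>F u\<close>. The real parts then contribute
      \<open>- \<delta> * (Re w - Re u)\<close>, and the strip bounds the imaginary
      contribution.\<close>
    have "(v - F w) \<bullet> (u - w) \<le> 0" using w \<open>u \<in> ?C\<close> by blast
    moreover have "(F w - F u) \<bullet> (w - u) \<ge> 0" using F_monotone w uc by blast
    moreover have "(v - F u) \<bullet> (w - u) = (F w - F u) \<bullet> (w - u) - (v - F w) \<bullet> (u - w)"
      by (simp add: algebra_simps)
    ultimately have "(v - F u) \<bullet> (w - u) \<ge> 0" by linarith
    then have "\<delta> * (Re w - Re u) \<le> Im (v - F u) * Im (w - u)"
      by (simp add: inner_complex_def \<delta>_def algebra_simps)
    also have "\<dots> \<le> \<bar>Im (v - F u)\<bar> * \<bar>Im (w - u)\<bar>" by (simp flip: abs_mult)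
    also have "\<dots> \<le> \<bar>Im (v - F u)\<bar> * (2 * M)"
      using strip(1)[OF uc] strip(1)[of w] w by (intro mult_left_mono) auto
    finally have "Re w - Re u \<le> \<bar>Im (v - F u)\<bar> * (2 * M) / \<delta>"
      using \<delta> by (simp add: field_simps)
    then have "Re w < R" by (simp add: R_def)
    have "(v - F w) \<bullet> (x - w) \<le> 0" if "x \<in> closure \<Omega>" for x
      by (rule variational_inequality_local[of "closure \<Omega>" w "{w. Re w < R}"])
         (use that w \<open>Re w < R\<close> in \<open>auto simp: convex_closure convex_dom open_halfspace_Re_lt\<close>)
    then show ?thesis
      using variational_solution_in_normal_ray[OF v] w unfolding outer_normal_def by blast
  qed
  show ?thesis
  proof (cases "bdd_above (Re ` F ` \<Omega>)")
    case False
    have "v \<in> \<Union>normal_rays" if v: "v \<notin> F ` \<Omega>" for v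
      using False solve[OF v] unfolding bdd_above_def by (metis imageE linorder_not_le)
    then have "- (F ` \<Omega>) = \<Union>normal_rays"
      using normal_ray_disjoint_image by blast
    then show ?thesis
      using close_to_convex_imageI[OF normal_rays_half_lines] normal_rays_non_crossing
      by (simp add: pairwise_def)
  next
    case True
    define a where "a = Sup (Re ` F ` \<Omega>)"
    define H where "H = (\<lambda>y. ray (Complex a y) 1) ` UNIV"
    have le: "Re (F z) \<le> a" if "z \<in> \<Omega>" for z
      unfolding a_def using True that by (intro cSup_upper) auto
    \<comment> \<open>Openness makes the bound strict, so rays starting on the line
      \<open>Re z = a\<close> miss the image.\<close>
    have less: "Re z < a" if z: "z \<in> F ` \<Omega>" for z
    proof -
      obtain e where e: "e > 0" "cball z e \<subseteq> F ` \<Omega>"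
        using open_image_F z open_contains_cball by blast
      have "z + of_real e \<in> cball z e" using e by (simp add: dist_norm)
      with e(2) have "z + of_real e \<in> F ` \<Omega>" by (rule subsetD)
      then obtain y where "y \<in> \<Omega>" "z + of_real e = F y" by (rule imageE)
      with le[of y] have "Re (z + of_real e) \<le> a" by simp
      with e show ?thesis by simp
    qed
    have "F ` closure \<Omega> \<subseteq> closure (F ` \<Omega>)"
      by (rule image_closure_subset[OF continuous_F closed_closure closure_subset])
    moreover have "closure (F ` \<Omega>) \<subseteq> {z. Re z \<le> a}"
      by (rule closure_minimal) (use le closed_halfspace_Re_le in auto)
    ultimately have le': "Re (F w) \<le> a" if "w \<in> closure \<Omega>" for w using that by blast
    \<comment> \<open>Since the domain contains its translates to the right, an outer normal has no
      positive real part; normal rays thus never pass the line \<open>Re z = a\<close>.\<close>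
    have normal_le: "Re z \<le> a" if L_ray: "L \<in> normal_rays" and z_in: "z \<in> L" for L z
    proof -
      obtain w n where L: "L = ray (F w) n" and w: "w \<in> closure \<Omega>"
        and n: "n \<noteq> 0" "outer_normal w n"
        using L_ray unfolding normal_rays_def frontier_dom by blast
      obtain t where t: "t \<ge> 0" "z = F w + of_real t * n"
        using z_in unfolding L ray_def by blast
      obtain x where x: "x \<in> \<Omega>" using dom_nonempty by blast
      have "Re n \<le> 0"
      proof (rule ccontr)
        assume "\<not> Re n \<le> 0"
        \<comment> \<open>Translation by at least \<open>- (n \<bullet> (x - w)) / Re n\<close>
          makes the inner product with \<open>n\<close> nonnegative.\<close>
        define s where "s = max 0 (- (n \<bullet> (x - w)) / Re n)"
        have "n \<bullet> (x + of_real s - w) < 0"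
          using outer_normal_strict[OF n(2,1)] transl[OF x, of s] by (simp add: s_def)
        then have "n \<bullet> (x - w) + Re n * s < 0"
          by (simp add: inner_complex_def algebra_simps)
        moreover have "Re n * (- (n \<bullet> (x - w)) / Re n) \<le> Re n * s"
          using \<open>\<not> Re n \<le> 0\<close> by (intro mult_left_mono) (auto simp: s_def)
        ultimately show False using \<open>\<not> Re n \<le> 0\<close> by simp
      qed
      then have "t * Re n \<le> 0" using t by (simp add: mult_nonneg_nonpos)
      with le'[OF w] t show ?thesis by simp
    qed
    \<comment> \<open>Normal rays may touch the line \<open>Re z = a\<close>, but the relative
      interiors of the horizontal rays lie strictly to its right.\<close>
    have H_rel: "Re z > a \<and> Im z = y" if "z \<in> rel_interior (ray (Complex a y) 1)" for z y
      using rel_interior_ray_subset[of 1 "Complex a y"] that by auto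
    have non_crossing: "pairwise (\<lambda>L M. disjnt (rel_interior L) (rel_interior M)) (normal_rays \<union> H)"
    proof (rule pairwiseI)
      fix L M assume LM: "L \<in> normal_rays \<union> H" "M \<in> normal_rays \<union> H" "L \<noteq> M"
      have mixed: "disjnt (rel_interior L) (rel_interior M)"
        if "L \<in> normal_rays" "M \<in> H" for L M
      proof -
        obtain y where M: "M = ray (Complex a y) 1" using \<open>M \<in> H\<close> unfolding H_def by (rule imageE)
        show ?thesis
          using normal_le[OF \<open>L \<in> normal_rays\<close>] H_rel rel_interior_subset[of L]
          unfolding disjnt_iff M by (metis linorder_not_less subsetD)
      qed
      have HH: "disjnt (rel_interior L) (rel_interior M)" if H: "L \<in> H" "M \<in> H" "L \<noteq> M" for L M
      proof -
        obtain x y where "L = ray (Complex a x) 1" "M = ray (Complex a y) 1"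
          using H unfolding H_def by blast
        with \<open>L \<noteq> M\<close> show ?thesis
          using H_rel unfolding disjnt_iff by metis
      qed
      show "disjnt (rel_interior L) (rel_interior M)"
        using LM mixed HH normal_rays_non_crossing by (metis Un_iff disjnt_sym)
    qed
    have H_covers: "v \<in> ray (Complex a (Im v)) 1" if "Re v \<ge> a" for v
      unfolding ray_def using that by (auto simp: complex_eq_iff intro!: exI[of _ "Re v - a"])
    have "v \<in> \<Union>(normal_rays \<union> H)" if v: "v \<notin> F ` \<Omega>" for v
    proof (cases "Re v < a")
      case True
      then obtain u where "u \<in> \<Omega>" "Re v < Re (F u)"
        using less_cSupE[of "Re v" "Re ` F ` \<Omega>"] dom_nonempty unfolding a_def by blast
      then show ?thesis using solve[OF v] by blast
    next
      case False
      then show ?thesis using H_covers[of v] unfolding H_def by auto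
    qed
    moreover have "L \<inter> F ` \<Omega> = {}" if L: "L \<in> H" for L
    proof -
      obtain y where "L = ray (Complex a y) 1" using L unfolding H_def by (rule imageE)
      then have "Re z \<ge> a" if "z \<in> L" for z using that unfolding ray_def by auto
      with less show ?thesis by (force simp: not_le[symmetric])
    qed
    ultimately have "- (F ` \<Omega>) = \<Union>(normal_rays \<union> H)"
      using normal_ray_disjoint_image by blast
    moreover have "closed_half_line L" if "L \<in> normal_rays \<union> H" for L
      using that normal_rays_half_lines closed_half_line_ray[of 1] unfolding H_def by auto
    ultimately show ?thesis
      using close_to_convex_imageI non_crossing by blast
  qed
qed

end

subsection \<open>Convex images of the disc\<close>

text \<open>If a convex combination \<open>c\<close> of points of \<open>K\<close> were outside, the
  segment from \<open>p\<close> to \<open>c\<close> would meet the frontier at some \<open>q\<close>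
  other than \<open>c\<close>. The normal at \<open>q\<close> is negative at \<open>p\<close> and
  nonpositive at \<open>c\<close>, hence negative at \<open>q\<close> itself, where it
  vanishes.\<close>

lemma convex_if_supporting_hyperplanes:
  fixes K :: "'a::euclidean_space set"
  assumes "closed K" and p: "p \<in> interior K"
    and support: "\<And>q. q \<in> frontier K \<Longrightarrow> \<exists>n. n \<noteq> 0 \<and> (\<forall>x\<in>K. n \<bullet> (x - q) \<le> 0)"
  shows "convex K"
proof (rule convexI, rule ccontr)
  fix a b and u v :: real
  assume ab: "a \<in> K" "b \<in> K" and uv: "0 \<le> u" "0 \<le> v" "u + v = 1"
  define c where "c = u *\<^sub>R a + v *\<^sub>R b"
  assume "u *\<^sub>R a + v *\<^sub>R b \<notin> K"
  then have "c \<notin> K" by (simp add: c_def)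
  moreover have "p \<in> K" using p interior_subset by blast
  ultimately have "closed_segment p c \<inter> frontier K \<noteq> {}"
    by (intro connected_Int_frontier) auto
  then obtain q where q: "q \<in> closed_segment p c" "q \<in> frontier K" by blast
  then obtain n where n: "n \<noteq> 0" "\<And>x. x \<in> K \<Longrightarrow> n \<bullet> (x - q) \<le> 0" using support by blast
  obtain s where s: "0 \<le> s" "s \<le> 1" "q = (1 - s) *\<^sub>R p + s *\<^sub>R c"
    using q(1) by (auto simp: in_segment)
  have "q \<in> K" using q(2) \<open>closed K\<close> frontier_subset_closed by blast
  then have "s < 1" using s \<open>c \<notin> K\<close> by (cases "s = 1") auto
  have np: "n \<bullet> (p - q) < 0" using supporting_normal_interior[OF n(1) p n(2)] by blast
  have "c - q = u *\<^sub>R (a - q) + v *\<^sub>R (b - q)"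
    using uv(3) by (simp add: c_def algebra_simps flip: scaleR_left.add)
  then have "n \<bullet> (c - q) = u * (n \<bullet> (a - q)) + v * (n \<bullet> (b - q))"
    by (simp add: inner_add_right)
  also have "\<dots> \<le> 0"
    using n(2)[OF ab(1)] n(2)[OF ab(2)] uv by (simp add: add_nonpos_nonpos mult_nonneg_nonpos)
  finally have "s * (n \<bullet> (c - q)) \<le> 0" using s by (simp add: mult_nonneg_nonpos)
  moreover have "(1 - s) * (n \<bullet> (p - q)) < 0" using np \<open>s < 1\<close> by (simp add: mult_pos_neg)
  moreover have "(1 - s) * (n \<bullet> (p - q)) + s * (n \<bullet> (c - q)) = n \<bullet> ((1 - s) *\<^sub>R p + s *\<^sub>R c - q)"
    by (simp add: algebra_simps)
  ultimately show False using s(3) by simp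
qed

lemma inner_eq_Re_cnj: "x \<bullet> y = Re (cnj x * y)" for x y :: complex
  by (simp add: inner_complex_def)

lemma Re_of_real_mult: "Re (of_real a * z) = a * Re z" for z :: complex
  by simp

text \<open>With \<open>h' = exp q\<close>, the outer normal of \<open>s \<mapsto> h (r exp (i s))\<close> has argument \<open>s + Im q\<close>, which is
  nondecreasing and grows by \<open>2 pi\<close> over one turn. So the component of the curve along a fixed normal
  first decreases and then increases back to its starting value.\<close>

lemma support_on_circle:
  assumes q: "q holomorphic_on ball 0 1"
    and h: "\<And>z. z \<in> ball 0 1 \<Longrightarrow> (h has_field_derivative exp (q z)) (at z)"
    and Re: "\<And>z. z \<in> ball 0 1 \<Longrightarrow> Re (z * deriv q z) \<ge> - 1"
    and r: "0 < r" "r < 1" and z: "norm z0 = r" "norm z1 = r"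
  shows "(z0 * exp (q z0)) \<bullet> (h z1 - h z0) \<le> 0"
proof -
  define c where "c = (\<lambda>s::real. of_real r * exp (\<i> * of_real s))"
  define t where "t = Arg2pi z0"
  \<comment> \<open>The angle of \<open>z1\<close>, lifted to the turn that starts at the angle
    \<open>t\<close> of \<open>z0\<close>.\<close>
  define x where "x = (if Arg2pi z1 \<ge> t then Arg2pi z1 else Arg2pi z1 + 2 * pi)"
  have c_norm: "norm (c s) = r" for s using r by (simp add: c_def norm_mult)
  have c_ball: "c s \<in> ball 0 1" for s using r c_norm by simp
  have c_per: "c (s + 2 * pi) = c s" for s
    by (simp add: c_def exp_add distrib_left mult_ac)
  have z0: "z0 = c t" unfolding c_def t_def using Arg2pi_eq[of z0] z(1) by simp
  have z1: "z1 = c x" using Arg2pi_eq[of z1] z(2) c_per[of "Arg2pi z1"]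
    by (simp add: c_def x_def)
  have x: "t \<le> x" "x \<le> t + 2 * pi"
    using Arg2pi_lt_2pi[of z0] Arg2pi_lt_2pi[of z1] Arg2pi_ge_0[of z0] Arg2pi_ge_0[of z1]
    by (auto simp: x_def t_def)
  have c_deriv: "(c has_vector_derivative \<i> * c s) (at s)" for s
    unfolding c_def
    by (rule has_vector_derivative_real_field) (auto intro!: derivative_eq_intros)
  \<comment> \<open>\<open>\<psi>\<close> is the angle through which the normal has turned since
    \<open>t\<close>, and \<open>u\<close> is the component of the chord along the normal at
    \<open>t\<close>.\<close>
  define \<psi> where "\<psi> = (\<lambda>s. s - t + Im (q (c s)) - Im (q (c t)))"
  define u where "u = (\<lambda>s. Re (cnj (c t * exp (q (c t))) * (h (c s) - h (c t))))"
  have qc: "((\<lambda>s. q (c s)) has_vector_derivative (\<i> * c s * deriv q (c s))) (at s)" for s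
  proof -
    have "(q has_field_derivative deriv q (c s)) (at (c s))"
      using q c_ball by (intro holomorphic_derivI[of _ "ball 0 1"]) auto
    from field_vector_diff_chain_at[OF c_deriv this] show ?thesis by (simp add: o_def)
  qed
  have \<psi>_deriv: "(\<psi> has_real_derivative 1 + Re (c s * deriv q (c s))) (at s)" for s
  proof -
    have "((\<lambda>s. Im (q (c s))) has_vector_derivative Im (\<i> * c s * deriv q (c s))) (at s)"
      using bounded_linear.has_vector_derivative[OF bounded_linear_Im qc] .
    then have "((\<lambda>s. Im (q (c s))) has_real_derivative Re (c s * deriv q (c s))) (at s)"
      by (simp add: has_real_derivative_iff_has_vector_derivative)
    then have "(\<psi> has_real_derivative 1 - 0 + Re (c s * deriv q (c s)) - 0) (at s)"
      unfolding \<psi>_def by (intro DERIV_diff DERIV_add DERIV_ident DERIV_const)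
    then show ?thesis by simp
  qed
  have \<psi>_mono: "\<psi> a \<le> \<psi> b" if "a \<le> b" for a b
  proof (rule DERIV_nonneg_imp_nondecreasing[OF that])
    fix s
    show "\<exists>y. (\<psi> has_real_derivative y) (at s) \<and> 0 \<le> y"
      using \<psi>_deriv[of s] Re[OF c_ball, of s] by (intro exI conjI) auto
  qed
  have \<psi>_ends: "\<psi> t = 0" "\<psi> (t + 2 * pi) = 2 * pi"
    unfolding \<psi>_def c_per by auto
  have u_deriv: "(u has_real_derivative
      - (r\<^sup>2 * exp (Re (q (c t)) + Re (q (c s))) * sin (\<psi> s))) (at s)" for s
  proof -
    have "((\<lambda>s. h (c s)) has_vector_derivative (\<i> * c s * exp (q (c s)))) (at s)"
      using field_vector_diff_chain_at[OF c_deriv h[OF c_ball]] by (simp add: o_def)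
    then have "((\<lambda>s. cnj (c t * exp (q (c t))) * (h (c s) - h (c t))) has_vector_derivative
        cnj (c t * exp (q (c t))) * (\<i> * c s * exp (q (c s)) - 0)) (at s)"
      by (intro has_vector_derivative_mult_right has_vector_derivative_diff
           has_vector_derivative_const)
    from bounded_linear.has_vector_derivative[OF bounded_linear_Re this]
    have "(u has_real_derivative Re (cnj (c t * exp (q (c t))) * (\<i> * c s * exp (q (c s))))) (at s)"
      unfolding u_def by (simp add: has_real_derivative_iff_has_vector_derivative)
    moreover have "cnj (c t * exp (q (c t))) * (\<i> * c s * exp (q (c s)))
        = of_real (r\<^sup>2) * (\<i> * exp (- \<i> * of_real t + cnj (q (c t)) + \<i> * of_real s + q (c s)))"
      by (simp add: c_def exp_add exp_diff exp_minus exp_cnj power2_eq_square divide_inverse mult_ac)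
    moreover have "Re (\<i> * exp (- \<i> * of_real t + cnj (q (c t)) + \<i> * of_real s + q (c s)))
        = - (exp (Re (q (c t)) + Re (q (c s))) * sin (\<psi> s))"
      by (simp add: Im_exp \<psi>_def algebra_simps)
    ultimately show ?thesis by (simp only: Re_of_real_mult) (simp add: mult_ac)
  qed
  have u_ends: "u t = 0" "u (t + 2 * pi) = 0" unfolding u_def c_per by auto
  have "u x \<le> 0"
  \<comment> \<open>Monotonicity of \<open>\<psi>\<close> fixes the sign of its sine on the whole
    interval from \<open>x\<close> to one end of the turn, and \<open>u\<close> vanishes at both
    ends.\<close>
  proof (cases "\<psi> x \<le> pi")
    case True
    have "u x \<le> u t"
    proof (rule DERIV_nonpos_imp_nonincreasing[OF x(1)])
      fix s assume s: "t \<le> s" "s \<le> x"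
      have "sin (\<psi> s) \<ge> 0"
        using \<psi>_mono[OF s(1)] \<psi>_mono[OF s(2)] True \<psi>_ends by (intro sin_ge_zero) auto
      then have "- (r\<^sup>2 * exp (Re (q (c t)) + Re (q (c s))) * sin (\<psi> s)) \<le> 0" by simp
      with u_deriv[of s] show "\<exists>y. (u has_real_derivative y) (at s) \<and> y \<le> 0" by blast
    qed
    then show ?thesis using u_ends by simp
  next
    case False
    have "u x \<le> u (t + 2 * pi)"
    proof (rule DERIV_nonneg_imp_nondecreasing[OF x(2)])
      fix s assume s: "x \<le> s" "s \<le> t + 2 * pi"
      have "sin (\<psi> s) \<le> 0"
        using \<psi>_mono[OF s(1)] \<psi>_mono[OF s(2)] False \<psi>_ends sin_ge_zero[of "\<psi> s - pi"]
        by (simp add: sin_diff)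
      then have "0 \<le> - (r\<^sup>2 * exp (Re (q (c t)) + Re (q (c s))) * sin (\<psi> s))"
        by (simp add: mult_nonneg_nonpos)
      with u_deriv[of s] show "\<exists>y. (u has_real_derivative y) (at s) \<and> 0 \<le> y" by blast
    qed
    then show ?thesis using u_ends by simp
  qed
  then show ?thesis by (simp add: u_def z0 z1 inner_eq_Re_cnj)
qed

text \<open>As \<open>h\<close> need not have boundary values on the unit circle, convexity is shown
  for images of smaller closed discs; any two points of the unit disc lie in one of them.\<close>

theorem convex_image_disc:
  assumes holo: "h holomorphic_on ball 0 1" and nz: "\<And>z. z \<in> ball 0 1 \<Longrightarrow> deriv h z \<noteq> 0"
    and Re: "\<And>z. z \<in> ball 0 1 \<Longrightarrow> Re (z * deriv (deriv h) z / deriv h z) \<ge> - 1"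
  shows "convex (h ` ball 0 1)"
proof -
  have "deriv h holomorphic_on ball 0 1" by (intro holomorphic_deriv holo open_ball)
  \<comment> \<open>A nonvanishing derivative has a holomorphic logarithm on the disc, and
    \<open>deriv q\<close> is then the quotient of the second and first derivatives of
    \<open>h\<close>.\<close>
  then obtain q where q: "q holomorphic_on ball 0 1" "\<And>z. z \<in> ball 0 1 \<Longrightarrow> deriv h z = exp (q z)"
    using simply_connected_eq_holomorphic_log[OF open_ball, of "0::complex" 1]
      convex_imp_simply_connected[OF convex_ball, of "0::complex" 1] nz by metis
  have h_deriv: "(h has_field_derivative exp (q z)) (at z)" if "z \<in> ball 0 1" for z
    using holomorphic_derivI[OF holo open_ball that] q(2)[OF that] by simp
  have q_Re: "Re (z * deriv q z) \<ge> - 1" if z: "z \<in> ball 0 1" for z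
  proof -
    have "((\<lambda>z. exp (q z)) has_field_derivative exp (q z) * deriv q z) (at z)"
      using holomorphic_derivI[OF q(1) open_ball z] by (auto intro!: derivative_eq_intros)
    then have "(deriv h has_field_derivative exp (q z) * deriv q z) (at z)"
      by (rule has_field_derivative_transform_within_open[OF _ open_ball z]) (use q(2) in auto)
    then have "deriv (deriv h) z = exp (q z) * deriv q z" by (rule DERIV_imp_deriv)
    then show ?thesis using Re[OF z] q(2)[OF z] by simp
  qed
  have conv: "convex (h ` cball 0 r)" if r: "0 < r" "r < 1" for r
  proof (rule convex_if_supporting_hyperplanes)
    have cont: "continuous_on (cball 0 r) h"
      using holo r by (intro holomorphic_on_imp_continuous_on holomorphic_on_subset[OF holo]) auto
    then have "compact (h ` cball 0 r)" by (simp add: compact_continuous_image)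
    then show closed: "closed (h ` cball 0 r)" by (rule compact_imp_closed)
    have "\<not> h constant_on ball 0 1"
    proof
      assume "h constant_on ball 0 1"
      then obtain k where k: "\<And>z. z \<in> ball 0 1 \<Longrightarrow> h z = k" by (auto simp: constant_on_def)
      have "(h has_field_derivative 0) (at 0)"
        by (rule has_field_derivative_transform_within_open[where f = "\<lambda>_. k" and S = "ball 0 1"])
           (simp_all add: k)
      then have "deriv h 0 = 0" by (rule DERIV_imp_deriv)
      with nz[of 0] show False by simp
    qed
    then have "open (h ` ball 0 r)"
      using r by (intro open_mapping_thm[OF holo]) auto
    then have inter: "h ` ball 0 r \<subseteq> interior (h ` cball 0 r)"
      by (intro interior_maximal image_mono ball_subset_cball)
    then show "h 0 \<in> interior (h ` cball 0 r)" using r by auto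
    fix y assume "y \<in> frontier (h ` cball 0 r)"
    then have y: "y \<in> h ` cball 0 r" "y \<notin> h ` ball 0 r"
      using inter closed by (auto simp: frontier_def)
    then obtain z0 where z0: "y = h z0" "norm z0 = r" by (force simp: image_iff)
    define n where "n = z0 * exp (q z0)"
    have "n \<bullet> (x - y) \<le> 0" if x: "x \<in> h ` cball 0 r" for x
    proof -
      obtain z where z: "z \<in> cball 0 r" "x = h z" using x by blast
      \<comment> \<open>The maximum principle carries the support inequality from the circle to the
        disc.\<close>
      have "Re (cnj n * (h z - y)) \<le> 0"
      proof (rule maximum_real_frontier[where S = "cball 0 r" and f = "\<lambda>z. cnj n * (h z - y)"])
        show "(\<lambda>z. cnj n * (h z - y)) holomorphic_on interior (cball 0 r)"
          using r by (intro holomorphic_intros holomorphic_on_subset[OF holo]) auto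
        show "continuous_on (closure (cball 0 r)) (\<lambda>z. cnj n * (h z - y))"
          using cont by (auto intro!: continuous_intros)
        show "Re (cnj n * (h z - y)) \<le> 0" if "z \<in> frontier (cball 0 r)" for z
        proof -
          have "norm z = r" using that r by simp
          then show ?thesis
            using support_on_circle[OF q(1) h_deriv q_Re r z0(2), of z]
            by (simp add: n_def z0(1) inner_eq_Re_cnj)
        qed
      qed (use z in auto)
      then show ?thesis by (simp add: z(2) inner_eq_Re_cnj)
    qed
    moreover have "n \<noteq> 0" using z0 r by (auto simp: n_def)
    ultimately show "\<exists>n. n \<noteq> 0 \<and> (\<forall>x\<in>h ` cball 0 r. n \<bullet> (x - y) \<le> 0)" by blast
  qed
  show ?thesis
  proof (rule convexI)
    fix a b and u v :: real
    assume "a \<in> h ` ball 0 1" "b \<in> h ` ball 0 1" and uv: "0 \<le> u" "0 \<le> v" "u + v = 1"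
    then obtain z1 z2 where z: "norm z1 < 1" "norm z2 < 1" "a = h z1" "b = h z2" by auto
    define r where "r = (1 + max (norm z1) (norm z2)) / 2"
    have r: "0 < r" "r < 1" "norm z1 \<le> r" "norm z2 \<le> r"
      using z by (auto simp: r_def max_def add_pos_nonneg)
    then have "u *\<^sub>R a + v *\<^sub>R b \<in> h ` cball 0 r"
      using z uv by (intro convexD[OF conv]) auto
    also have "\<dots> \<subseteq> h ` ball 0 1" using r by auto
    finally show "u *\<^sub>R a + v *\<^sub>R b \<in> h ` ball 0 1" .
  qed
qed

subsection \<open>Harmonic mappings with convex analytic part\<close>

text \<open>The derivative bound is only pointwise, but on the compact segment its norm attains a
  maximum, which is still less than 1.\<close>

lemma holomorphic_strict_contraction:
  assumes "g holomorphic_on S" "open S" "convex S"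
    and bound: "\<And>z. z \<in> S \<Longrightarrow> norm (deriv g z) < 1"
    and zw: "z \<in> S" "w \<in> S" "z \<noteq> w"
  shows "norm (g z - g w) < norm (z - w)"
proof -
  let ?C = "closed_segment z w"
  have sub: "?C \<subseteq> S" using assms closed_segment_subset by blast
  have "continuous_on ?C (\<lambda>x. norm (deriv g x))"
    using holomorphic_on_imp_continuous_on[OF holomorphic_deriv[OF assms(1,2)]]
    by (intro continuous_on_norm continuous_on_subset[OF _ sub])
  then obtain x where x: "x \<in> ?C" "\<And>y. y \<in> ?C \<Longrightarrow> norm (deriv g y) \<le> norm (deriv g x)"
    using continuous_attains_sup[of ?C "\<lambda>x. norm (deriv g x)"] by auto
  have "norm (g z - g w) \<le> norm (deriv g x) * norm (z - w)"
  proof (rule field_differentiable_bound[of ?C])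
    show "(g has_field_derivative deriv g y) (at y within ?C)" if "y \<in> ?C" for y
      using holomorphic_derivI[OF assms(1,2) subsetD[OF sub that]]
      by (rule has_field_derivative_at_within)
    show "norm (deriv g y) \<le> norm (deriv g x)" if "y \<in> ?C" for y
      using that by (rule x(2))
  qed simp_all
  also have "\<dots> < 1 * norm (z - w)"
    using bound[OF subsetD[OF sub x(1)]] zw(3) by (intro mult_strict_right_mono) simp_all
  finally show ?thesis by simp
qed

text \<open>The Noshiro-Warschawski criterion: along the segment from \<open>z\<close> to
  \<open>w\<close> the component of \<open>h\<close> in the direction \<open>w - z\<close> strictly
  increases.\<close>

lemma inj_on_Re_deriv_pos:
  assumes "h holomorphic_on S" "open S" "convex S"
    and Re: "\<And>z. z \<in> S \<Longrightarrow> Re (deriv h z) > 0"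
  shows "inj_on h S"
proof (rule inj_onI, rule ccontr)
  fix z w assume zw: "z \<in> S" "w \<in> S" "h z = h w" "z \<noteq> w"
  define l where "l = (\<lambda>t::real. z + of_real t * (w - z))"
  define k where "k = (\<lambda>t. Re (cnj (w - z) * h (l t)))"
  have "k 0 < k 1"
  proof (rule DERIV_pos_imp_increasing[where a = 0 and b = 1 and f = k])
    fix t :: real assume t: "0 \<le> t" "t \<le> 1"
    have "l t \<in> closed_segment z w"
      using t by (auto simp: l_def in_segment scaleR_conv_of_real algebra_simps intro!: exI[of _ t])
    then have lt: "l t \<in> S" using zw assms closed_segment_subset by blast
    have "(l has_vector_derivative (w - z)) (at t)"
      unfolding l_def by (rule has_vector_derivative_real_field) (auto intro!: derivative_eq_intros)
    from field_vector_diff_chain_at[OF this holomorphic_derivI[OF assms(1,2) lt]]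
    have "((\<lambda>t. h (l t)) has_vector_derivative (w - z) * deriv h (l t)) (at t)"
      by (simp add: o_def)
    then have "((\<lambda>t. cnj (w - z) * h (l t)) has_vector_derivative
        cnj (w - z) * ((w - z) * deriv h (l t))) (at t)"
      by (rule has_vector_derivative_mult_right)
    from bounded_linear.has_vector_derivative[OF bounded_linear_Re this]
    have "(k has_real_derivative Re (cnj (w - z) * ((w - z) * deriv h (l t)))) (at t)"
      unfolding k_def by (simp only: has_real_derivative_iff_has_vector_derivative)
    moreover have "cnj (w - z) * ((w - z) * deriv h (l t)) = of_real ((norm (w - z))\<^sup>2) * deriv h (l t)"
      by (simp only: complex_norm_square mult_ac)
    moreover have "Re (of_real ((norm (w - z))\<^sup>2) * deriv h (l t)) > 0"
      using Re[OF lt] zw(4) by (simp only: Re_of_real_mult) simp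
    ultimately show "\<exists>y. (k has_real_derivative y) (at t) \<and> 0 < y" by metis
  qed simp
  then show False using zw(3) by (simp add: k_def l_def)
qed

text \<open>With \<open>k\<close> the inverse of \<open>h\<close>, the derivative of
  \<open>g \<circ> k\<close> is the dilatation, the quotient of \<open>deriv g\<close> by
  \<open>deriv h\<close>. It has norm below 1, so convexity of the image yields a strict
  contraction.\<close>

theorem harmonic_contraction_perturbation:
  assumes h: "h holomorphic_on S" and S: "open S" "S \<noteq> {}" and inj: "inj_on h S"
    and conv: "convex (h ` S)" and g: "g holomorphic_on S"
    and sense: "\<And>z. z \<in> S \<Longrightarrow> norm (deriv g z) < norm (deriv h z)"
  obtains A where "contraction_perturbation (h ` S) A" "\<And>z. z \<in> S \<Longrightarrow> A (h z) = - cnj (g z)"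
proof -
  have op: "open (h ` S)" by (rule open_mapping_thm3[OF h S(1) inj])
  obtain k where k: "k holomorphic_on h ` S" "\<And>z. z \<in> S \<Longrightarrow> deriv h z * deriv k (h z) = 1"
      "\<And>z. z \<in> S \<Longrightarrow> k (h z) = z"
    using holomorphic_has_inverse[OF h S(1) inj] by blast
  have "(g \<circ> k) holomorphic_on h ` S"
    by (rule holomorphic_on_compose_gen[OF k(1) g]) (use k(3) in auto)
  moreover have "norm (deriv (g \<circ> k) w) < 1" if w: "w \<in> h ` S" for w
  proof -
    obtain z where z: "z \<in> S" "w = h z" using w by blast
    have "deriv (g \<circ> k) w = deriv g z * deriv k w"
      using deriv_chain[of k w g] k holomorphic_on_imp_differentiable_at[OF k(1) op w]
        holomorphic_on_imp_differentiable_at[OF g S(1)] z by simp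
    then have "norm (deriv (g \<circ> k) w) = norm (deriv g z) * norm (deriv k w)"
      by (simp add: norm_mult)
    also have "\<dots> < norm (deriv h z) * norm (deriv k w)"
      using sense[OF z(1)] k(2)[OF z(1)] z(2) by (intro mult_strict_right_mono) auto
    also have "\<dots> = 1" using k(2)[OF z(1)] z(2) by (metis norm_mult norm_one)
    finally show ?thesis .
  qed
  ultimately have less: "norm (g (k z) - g (k w)) < norm (z - w)"
    if "z \<in> h ` S" "w \<in> h ` S" "z \<noteq> w" for z w
    using holomorphic_strict_contraction[OF _ op conv] that by (metis comp_apply)
  have cnj_less: "norm (- cnj (g (k z)) - - cnj (g (k w))) < norm (z - w)"
    if "z \<in> h ` S" "w \<in> h ` S" "z \<noteq> w" for z w
  proof -
    have "- cnj (g (k z)) - - cnj (g (k w)) = cnj (g (k w) - g (k z))" by simp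
    then show ?thesis using less[OF that] by (simp only: complex_mod_cnj norm_minus_commute)
  qed
  have "1-lipschitz_on (h ` S) (\<lambda>w. - cnj (g (k w)))"
  proof (rule lipschitz_onI)
    fix z w assume zw: "z \<in> h ` S" "w \<in> h ` S"
    show "dist (- cnj (g (k z))) (- cnj (g (k w))) \<le> 1 * dist z w"
    proof (cases "z = w")
      case False
      from less_imp_le[OF cnj_less[OF zw this]] show ?thesis
        by (simp only: dist_norm mult_1)
    qed simp
  qed simp
  from lipschitz_extend_closure[OF this]
  obtain A where A: "1-lipschitz_on (closure (h ` S)) A"
      "\<forall>w\<in>h ` S. A w = - cnj (g (k w))"
    by (elim exE conjE)
  have "contraction_perturbation (h ` S) A"
  proof
    show "norm (A z - A w) < norm (z - w)" if "z \<in> h ` S" "w \<in> h ` S" "z \<noteq> w" for z w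
      using cnj_less[OF that] A(2)[rule_format, OF that(1)] A(2)[rule_format, OF that(2)]
      by (simp only:)
  qed (use op conv S(2) A(1) in simp_all)
  then show thesis using that A(2) k(3) by simp
qed

text \<open>The bound is the value at \<open>w = - 1\<close>. After clearing denominators it follows
  from \<open>x\<^sup>2 + y\<^sup>2 \<le> 1\<close> and
  \<open>(m - 1) * (x + 1) \<ge> 0\<close>.\<close>

lemma Re_kernel_ge:
  fixes m :: real
  assumes "m \<ge> 1" "norm w < 1"
  shows "Re (of_real m / (of_real m - w)) \<ge> m / (m + 1)" "of_real m - w \<noteq> 0"
proof -
  show nz: "of_real m - w \<noteq> 0"
  proof
    assume "of_real m - w = 0"
    then have "w = of_real m" by simp
    then have "norm w = m" using assms(1) by simp
    with assms show False by simp
  qed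
  define x y where "x = Re w" and "y = Im w"
  have xy: "x\<^sup>2 + y\<^sup>2 \<le> 1" 
    using power_le_one[of "norm w" 2] assms(2) cmod_power2[of w] by (simp add: x_def y_def)
  have "\<bar>x\<bar> \<le> norm w" unfolding x_def by (rule abs_Re_le_cmod)
  then have x: "x \<ge> - 1" using assms(2) by linarith
  have D: "(m - x)\<^sup>2 + y\<^sup>2 > 0"
    using nz complex_neq_0[of "of_real m - w"] by (simp add: x_def y_def)
  have "(m - 1) * x \<ge> (m - 1) * (- 1)" using x assms(1) by (intro mult_left_mono) auto
  then have "(m - x)\<^sup>2 + y\<^sup>2 \<le> (m + 1) * (m - x)"
    using xy by (simp add: power2_eq_square algebra_simps)
  then have "m * ((m - x)\<^sup>2 + y\<^sup>2) \<le> m * ((m + 1) * (m - x))"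
    using assms(1) by (intro mult_left_mono) auto
  then have "m / (m + 1) \<le> m * (m - x) / ((m - x)\<^sup>2 + y\<^sup>2)"
    using D assms(1) by (simp add: field_simps)
  also have "\<dots> = Re (of_real m / (of_real m - w))"
    by (simp add: Re_divide x_def y_def)
  finally show "Re (of_real m / (of_real m - w)) \<ge> m / (m + 1)" .
qed

theorem harmonic_univalent_close_to_convex:
  assumes h: "h holomorphic_on \<D>" and inj: "inj_on h \<D>" and conv: "convex (h ` \<D>)"
    and g: "g holomorphic_on \<D>" and sense: "\<And>z. z \<in> \<D> \<Longrightarrow> norm (deriv g z) < norm (deriv h z)"
    and f: "\<And>z. z \<in> \<D> \<Longrightarrow> f z = h z + cnj (g z)"
    and shape: "bounded (h ` \<D>) \<or> (\<exists>M. \<forall>w\<in>h ` \<D>. \<bar>Im w\<bar> \<le> M \<and> - M \<le> Re w \<and>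
      (\<forall>t\<ge>0. w + of_real t \<in> h ` \<D>))"
  shows "univalent f \<and> close_to_convex f"
proof -
  have ne: "\<D> \<noteq> ({} :: complex set)" by simp
  obtain A where "contraction_perturbation (h ` \<D>) A" and A: "\<And>z. z \<in> \<D> \<Longrightarrow> A (h z) = - cnj (g z)"
    using harmonic_contraction_perturbation[OF h open_ball ne inj conv g sense] by blast
  then interpret contraction_perturbation "h ` \<D>" A by simp
  have fF: "f z = F (h z)" if "z \<in> \<D>" for z
    using f[OF that] A[OF that] by (simp add: F_def)
  have "f ` \<D> = F ` h ` \<D>"
    unfolding image_image using fF by (rule image_cong[OF refl])
  moreover have "close_to_convex_domain (F ` h ` \<D>)"
    using shape
  proof
    assume "\<exists>M. \<forall>w\<in>h ` \<D>. \<bar>Im w\<bar> \<le> M \<and> - M \<le> Re w \<and> (\<forall>t\<ge>0. w + of_real t \<in> h ` \<D>)"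
    then obtain M where "\<forall>w\<in>h ` \<D>. \<bar>Im w\<bar> \<le> M \<and> - M \<le> Re w \<and> (\<forall>t\<ge>0. w + of_real t \<in> h ` \<D>)" ..
    then show ?thesis by (intro close_to_convex_image_half_strip[of M]) blast+
  qed (rule close_to_convex_image_bounded)
  moreover have "inj_on f \<D>"
  proof (rule inj_onI)
    fix z w assume zw: "z \<in> \<D>" "w \<in> \<D>" "f z = f w"
    then have "h z = h w" using inj_onD[OF inj_F] fF by (metis imageI)
    then show "z = w" using inj_onD[OF inj] zw by blast
  qed
  ultimately show ?thesis by (simp add: univalent_def close_to_convex_def)
qed

section \<open>Analytic parts with derivative \<open>m / (m - z ^ m)\<close>\<close>

lemma deriv_kernel:
  assumes "h holomorphic_on \<D>" and m: "m \<ge> 1"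
    and h': "\<And>z. z \<in> \<D> \<Longrightarrow> deriv h z = of_nat m / (of_nat m - z ^ m)" and z: "z \<in> \<D>"
  shows "Re (deriv h z) > 0" "Re (z * deriv (deriv h) z / deriv h z) \<ge> - 1"
proof -
  have pow: "norm (z ^ m) < 1" using m z by (simp add: norm_power power_less_one_iff)
  have nz: "of_nat m - z ^ m \<noteq> 0" and Re: "Re (of_nat m / (of_nat m - z ^ m)) \<ge> real m / (real m + 1)"
    using Re_kernel_ge[OF _ pow, of "real m"] m by (simp_all add: add.commute)
  have "real m / (real m + 1) > 0" using m by simp
  then show "Re (deriv h z) > 0" using Re unfolding h'[OF z] by linarith
  have "((\<lambda>z. z ^ m) has_field_derivative of_nat m * z ^ (m - 1)) (at z)"
    by (auto intro!: derivative_eq_intros)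
  from DERIV_divide[OF DERIV_const[of "of_nat m"] DERIV_diff[OF DERIV_const[of "of_nat m"] this] nz]
  have "((\<lambda>z. of_nat m / (of_nat m - z ^ m)) has_field_derivative
      of_nat m * (of_nat m * z ^ (m - 1)) / (of_nat m - z ^ m)\<^sup>2) (at z)"
    by (simp add: power2_eq_square)
  then have "(deriv h has_field_derivative
      of_nat m * (of_nat m * z ^ (m - 1)) / (of_nat m - z ^ m)\<^sup>2) (at z)"
    by (rule has_field_derivative_transform_within_open[OF _ open_ball z]) (simp add: h')
  then have h'': "deriv (deriv h) z = of_nat m * (of_nat m * z ^ (m - 1)) / (of_nat m - z ^ m)\<^sup>2"
    by (rule DERIV_imp_deriv)
  have zm: "z * z ^ (m - 1) = z ^ m" using m by (cases m) auto
  have quot: "z * (c * (c * p) / d\<^sup>2) / (c / d) = c * (z * p) / d"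
    if "c \<noteq> 0" "d \<noteq> 0" for c d p :: complex
    using that by (simp add: power2_eq_square)
  have diff: "c * p / (c - p) = c * (c / (c - p) - 1)" if "c - p \<noteq> 0" for c p :: complex
    using that by (simp add: field_simps)
  \<comment> \<open>With \<open>k = m / (m - z ^ m)\<close> this quotient is
    \<open>m * (k - 1)\<close>, and the lower bound for \<open>Re k\<close> makes its real part at
    least \<open>- m / (m + 1)\<close>.\<close>
  have "z * deriv (deriv h) z / deriv h z = of_nat m * (z * z ^ (m - 1)) / (of_nat m - z ^ m)"
    unfolding h'' h'[OF z] using nz m by (intro quot) auto
  also have "\<dots> = of_real (real m) * (of_nat m / (of_nat m - z ^ m) - 1)"
    unfolding zm of_real_of_nat_eq using nz by (rule diff)
  finally have eq: "Re (z * deriv (deriv h) z / deriv h z)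
      = real m * (Re (of_nat m / (of_nat m - z ^ m)) - 1)"
    by (simp only: Re_of_real_mult minus_complex.sel one_complex.sel)
  have "- 1 \<le> real m * (real m / (real m + 1) - 1)" by (simp add: field_simps)
  also have "\<dots> \<le> real m * (Re (of_nat m / (of_nat m - z ^ m)) - 1)"
    using Re by (intro mult_left_mono) auto
  finally show "Re (z * deriv (deriv h) z / deriv h z) \<ge> - 1" using eq by simp
qed

text \<open>Here \<open>deriv h\<close> has norm at most \<open>m / (m - 1)\<close>, which is at
  most 2.\<close>

lemma bounded_image_kernel:
  assumes holo: "h holomorphic_on \<D>" and m: "m \<ge> 2"
    and h': "\<And>z. z \<in> \<D> \<Longrightarrow> deriv h z = of_nat m / (of_nat m - z ^ m)"
  shows "bounded (h ` \<D>)"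
proof -
  have bound: "norm (deriv h z) \<le> 2" if z: "z \<in> \<D>" for z
  proof -
    have "norm (z ^ m) \<le> 1" using z by (simp add: norm_power power_le_one)
    then have "norm (of_nat m - z ^ m) \<ge> real m - 1"
      using norm_triangle_ineq2[of "of_nat m" "z ^ m"] by simp
    moreover have "real m \<ge> 2" using m by simp
    ultimately show ?thesis
      unfolding h'[OF z] norm_divide by (simp add: divide_le_eq)
  qed
  have "norm (h z - h 0) \<le> 2" if z: "z \<in> \<D>" for z
  proof -
    have "norm (h z - h 0) \<le> 2 * norm (z - 0)"
      by (rule field_differentiable_bound[of \<D>])
         (use holomorphic_derivI[OF holo open_ball] bound z in \<open>auto intro: has_field_derivative_at_within\<close>)
    then show ?thesis using z by simp
  qed
  then have "h ` \<D> \<subseteq> cball (h 0) 2" by (auto simp: dist_norm norm_minus_commute)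
  then show ?thesis using bounded_cball bounded_subset by blast
qed

text \<open>On the disc \<open>1 - z\<close> stays in the right half-plane, off the branch cut, so
  \<open>h z + Ln (1 - z)\<close> has zero derivative.\<close>

lemma log_kernel:
  assumes holo: "h holomorphic_on \<D>" and "h 0 = 0"
    and h': "\<And>z. z \<in> \<D> \<Longrightarrow> deriv h z = 1 / (1 - z)" and z: "z \<in> \<D>"
  shows "h z = - Ln (1 - z)"
proof -
  have pos: "Re (1 - w) > 0" if "w \<in> \<D>" for w
    using that abs_Re_le_cmod[of w] by simp
  have "\<exists>c. \<forall>w\<in>\<D>. h w + Ln (1 - w) = c"
  proof (rule has_field_derivative_zero_constant)
    fix w assume w: "w \<in> \<D>"
    have "1 - w \<notin> \<real>\<^sub>\<le>\<^sub>0" using pos[OF w] by (simp add: complex_nonpos_Reals_iff)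
    then have "((\<lambda>w. Ln (1 - w)) has_field_derivative inverse (1 - w) * (0 - 1)) (at w)"
      by (intro DERIV_chain2[OF has_field_derivative_Ln] DERIV_diff DERIV_const DERIV_ident)
    from DERIV_add[OF holomorphic_derivI[OF holo open_ball w] this]
    have "((\<lambda>w. h w + Ln (1 - w)) has_field_derivative 0) (at w)"
      unfolding h'[OF w] by (simp add: divide_inverse)
    then show "((\<lambda>w. h w + Ln (1 - w)) has_field_derivative 0) (at w within \<D>)"
      by (rule has_field_derivative_at_within)
  qed simp
  then obtain c where c: "\<forall>w\<in>\<D>. h w + Ln (1 - w) = c" by blast
  have "c = 0" using bspec[OF c, of 0] \<open>h 0 = 0\<close> by simp
  then show ?thesis using bspec[OF c z] by (simp add: eq_neg_iff_add_eq_0)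
qed

text \<open>The constant \<open>pi\<close> is a crude common bound for both coordinates. Translation
  by \<open>t\<close> shrinks \<open>1 - z\<close> by the factor \<open>exp (- t)\<close>, which
  moves \<open>z\<close> towards 1 inside the disc.\<close>

lemma log_kernel_half_strip:
  assumes h: "\<And>z. z \<in> \<D> \<Longrightarrow> h z = - Ln (1 - z)" and w: "w \<in> h ` \<D>"
  shows "\<bar>Im w\<bar> \<le> pi" "- pi \<le> Re w" "t \<ge> 0 \<Longrightarrow> w + of_real t \<in> h ` \<D>"
proof -
  obtain z where z: "z \<in> \<D>" "w = h z" using w by blast
  have nz: "1 - z \<noteq> 0" using z by auto
  show "\<bar>Im w\<bar> \<le> pi"
    using h[OF z(1)] Im_Ln_le_pi[OF nz] mpi_less_Im_Ln[OF nz] by (simp add: z(2))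
  have "norm (1 - z) \<le> 2" using z(1) norm_triangle_ineq4[of 1 z] by simp
  then have "ln (norm (1 - z)) \<le> norm (1 - z) - 1" using nz by (intro ln_le_minus_one) simp
  also have "\<dots> \<le> pi" using \<open>norm (1 - z) \<le> 2\<close> pi_gt3 by linarith
  finally show "- pi \<le> Re w" using h[OF z(1)] Re_Ln[OF nz] by (simp add: z(2))
  assume t: "t \<ge> 0"
  define y where "y = 1 - of_real (exp (- t)) * (1 - z)"
  \<comment> \<open>As a convex combination of 1 and \<open>z\<close> with positive weight on
    \<open>z\<close>, \<open>y\<close> stays in the disc.\<close>
  have "y = of_real (1 - exp (- t)) + of_real (exp (- t)) * z" by (simp add: y_def algebra_simps)
  then have "norm y \<le> norm (of_real (1 - exp (- t)) :: complex) + norm (of_real (exp (- t)) * z)"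
    using norm_triangle_ineq by blast
  also have "\<dots> = (1 - exp (- t)) + exp (- t) * norm z"
    using t by (simp only: norm_mult norm_of_real) simp
  also have "\<dots> < (1 - exp (- t)) + exp (- t) * 1"
    using z(1) by (intro add_strict_left_mono mult_strict_left_mono) auto
  finally have y: "y \<in> \<D>" by simp
  have "h y = - Ln (of_real (exp (- t)) * (1 - z))" using h[OF y] by (simp add: y_def)
  also have "\<dots> = - (of_real (ln (exp (- t))) + Ln (1 - z))"
    using Ln_times_of_real[OF exp_gt_zero nz, of "- t"] by (simp only: Ln_of_real[OF exp_gt_zero])
  also have "\<dots> = w + of_real t" using h[OF z(1)] by (simp add: z(2))
  finally show "w + of_real t \<in> h ` \<D>" using y by (metis imageI)
qed

theorem theorem2p2:
  fixes f :: "complex \<Rightarrow> complex"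
  assumes "f \<in> class_HR"
  shows "univalent f \<and> close_to_convex f"
proof -
  from assms obtain h g where rep: "harmonic_representation f h g" and "h \<in> class_R"
    unfolding class_HR_def by blast
  then have holo: "h holomorphic_on \<D>" "h 0 = 0"
    unfolding class_R_def class_A_def by auto
  have g: "g holomorphic_on \<D>" and f: "\<And>z. z \<in> \<D> \<Longrightarrow> f z = h z + cnj (g z)"
    and jac: "\<And>z. z \<in> \<D> \<Longrightarrow> jacobian h g z > 0"
    using rep unfolding harmonic_representation_def canonical_decomposition_def sense_preserving_def
    by auto
  obtain m where m: "m \<ge> (1::nat)"
    and "\<forall>z\<in>\<D>. deriv h z = of_nat m / (of_nat m - z ^ m)"
    using \<open>h \<in> class_R\<close> unfolding class_R_def by blast
  then have h': "\<And>z. z \<in> \<D> \<Longrightarrow> deriv h z = of_nat m / (of_nat m - z ^ m)" by blast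
  have kernel: "Re (deriv h z) > 0" "Re (z * deriv (deriv h) z / deriv h z) \<ge> - 1"
    if "z \<in> \<D>" for z
    by (rule deriv_kernel[OF holo(1) m h' that], assumption)+
  have "inj_on h \<D>"
    by (rule inj_on_Re_deriv_pos[OF holo(1) open_ball convex_ball kernel(1)])
  moreover have "convex (h ` \<D>)"
  proof (rule convex_image_disc[OF holo(1)])
    show "deriv h z \<noteq> 0" if "z \<in> \<D>" for z
    proof
      assume "deriv h z = 0"
      with kernel(1)[OF that] show False by simp
    qed
  qed (rule kernel(2))
  moreover have "norm (deriv g z) < norm (deriv h z)" if "z \<in> \<D>" for z
  proof -
    have "(norm (deriv g z))\<^sup>2 < (norm (deriv h z))\<^sup>2"
      using jac[OF that] by (simp add: jacobian_def)
    then show ?thesis by (rule power_less_imp_less_base) simp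
  qed
  moreover have "bounded (h ` \<D>) \<or> (\<exists>M. \<forall>w\<in>h ` \<D>. \<bar>Im w\<bar> \<le> M \<and> - M \<le> Re w \<and>
      (\<forall>t\<ge>0. w + of_real t \<in> h ` \<D>))"
  proof (cases "m = 1")
    case True
    have "h z = - Ln (1 - z)" if "z \<in> \<D>" for z
      using h' True by (intro log_kernel[OF holo _ that]) simp
    note strip = log_kernel_half_strip[OF this]
    show ?thesis
      by (intro disjI2 exI[of _ pi] ballI conjI allI impI strip)
  next
    case False
    with m have "m \<ge> 2" by simp
    from bounded_image_kernel[OF holo(1) this h'] show ?thesis by simp
  qed
  ultimately show ?thesis
    using harmonic_univalent_close_to_convex[OF holo(1) _ _ g _ f] by blast
qed

end
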